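(* Let $j\in\{2,3\}$ and let $j_1,j_2,j_1',j_2'$ be nonnegative integers with $j_1+j_2=j_1'+j_2'=j$. Suppose there exist an integer $n\ge 1$ and a finite set of integers $A$ such that (1) $A$ is a $P_n^j$-set; (2) $A\subset[1,2n]$ and $1,2n\in A$; (3) $|f_{j_1,j_2}(A)|>|f_{j_1',j_2'}(A)|$. Then there exists an infinite family of such sets, i.e. there are infinitely many finite sets of integers each of which satisfies (1), (2) and (3) for some positive integer $n$ (depending on the set).
   Context: For integers $a,b$, $[a,b]=\{x\in\mathbb{Z}: a\le x\le b\}$ (empty if $a>b$). For a finite set of integers $A$ and nonnegative integers $j_1,j_2$, $$f_{j_1,j_2}(A)=\{x_1+\cdots+x_{j_1}-y_1-\cdots-y_{j_2}: x_i,y_i\in A\},$$ the generalized sumset $A+\cdots+A-A-\cdots-A$ with $j_1$ pluses and $j_2$ minuses. $|X|$ denotes cardinality. Let $A\subset[1,k]$ with $1,k\in A$. $A$ is called a $P_n^j$-set if for all nonnegative integers $j_1,j_2$ with $j_1+j_2=j$, $f_{j_1,j_2}(A)$ contains all but the first $n$ and last $n$ possible elements, i.e. $[j_1-kj_2+n,\ kj_1-j_2-n]\subset f_{j_1,j_2}(A)$. *)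

theory Defs
  imports Main
begin

definition gen_sumset :: "nat \<Rightarrow> nat \<Rightarrow> int set \<Rightarrow> int set" where
  "gen_sumset j1 j2 A =
     {(\<Sum>i<j1. x i) - (\<Sum>i<j2. y i) | x y. (\<forall>i<j1. x i \<in> A) \<and> (\<forall>i<j2. y i \<in> A)}"

text \<open>The bound \<open>k\<close> is part of the data of the set: it is necessarily the maximum of \<open>A\<close>,
  so the existential quantifier below has at most one witness.\<close>

definition P_set :: "int \<Rightarrow> nat \<Rightarrow> int set \<Rightarrow> bool" where
  "P_set n j A \<longleftrightarrow>
     (\<exists>k. A \<subseteq> {1..k} \<and> 1 \<in> A \<and> k \<in> A \<and>
        (\<forall>j1 j2. j1 + j2 = j \<longrightarrow>
           {int j1 - k * int j2 + n .. k * int j1 - int j2 - n} \<subseteq> gen_sumset j1 j2 A))"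

end

theory Submission
  imports Defs
begin

text \<open>
  Cut a set \<open>A \<subseteq> [1, 2n]\<close> in the middle into \<open>L \<subseteq> [1, n]\<close> and \<open>R \<subseteq> [n + 1, 2n]\<close>, push the
  two halves apart by \<open>m\<close> and fill the gap, which gives
  \<open>A' = L \<union> [n + 1, n + m] \<union> (R + m) \<subseteq> [1, 2n + m]\<close>. For \<open>m \<ge> n\<close> this changes none of the
  cardinality differences between the sumsets with \<open>j\<close> summands.

  The reason is that \<open>f\<^bsub>j\<^sub>1,j\<^sub>2\<^esub>(A)\<close> splits into a lower fringe (the first \<open>n\<close> possible
  values), a middle part and an upper fringe (the last \<open>n\<close> possible values). A value in the lower
  fringe is within \<open>n\<close> of the minimum, so each of its summands is within \<open>n\<close> of the
  extreme position: pluses come from \<open>L\<close> and minuses come from \<open>R\<close>. Stretching therefore only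
  translates the fringe (\<open>card_low_fringe_cong\<close>). Negation exchanges the two fringes, so
  the same is true of the upper one. The middle part is full for \<open>A\<close> because \<open>A\<close> is a
  \<open>P\<^sub>n\<^sup>j\<close>-set, and full for \<open>A'\<close> because \<open>{1, k} \<union> [n + 1, k - n]\<close> with \<open>k \<ge> 3n\<close>
  already produces it (\<open>middle_subset_gen_sumset\<close>). The size of the middle part depends on \<open>j\<close>,
  \<open>k\<close> and \<open>n\<close> but not on how \<open>j\<close> is divided into pluses and minuses, so it cancels when two
  such sumsets are compared (\<open>card_gen_sumset\<close>).

  Finally, if \<open>m\<close> is even then \<open>A' \<subseteq> [1, 2n']\<close> with \<open>n' = n + m / 2 \<ge> n\<close>, and being full
  outside the first and last \<open>n\<close> values is stronger than being full outside the first and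
  last \<open>n'\<close>. Different \<open>m\<close> give different maxima, hence infinitely many sets.
\<close>

section \<open>Signed sumsets\<close>

text \<open>Letting the pluses and the minuses range over different sets is what makes it possible to
  describe a fringe, where they come from opposite ends of \<open>A\<close>.\<close>

definition signed_sumset :: "nat \<Rightarrow> nat \<Rightarrow> int set \<Rightarrow> int set \<Rightarrow> int set" where
  "signed_sumset j1 j2 X Y =
     {(\<Sum>i<j1. x i) - (\<Sum>i<j2. y i) | x y. (\<forall>i<j1. x i \<in> X) \<and> (\<forall>i<j2. y i \<in> Y)}"

lemma gen_sumset_eq_signed_sumset: "gen_sumset j1 j2 A = signed_sumset j1 j2 A A"
  by (simp add: gen_sumset_def signed_sumset_def)

lemma signed_sumset_mono:
  assumes "X \<subseteq> X'" "Y \<subseteq> Y'"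
  shows "signed_sumset j1 j2 X Y \<subseteq> signed_sumset j1 j2 X' Y'"
  using assms unfolding signed_sumset_def by blast

lemma gen_sumset_0_0: "gen_sumset 0 0 A = {0}"
  by (simp add: gen_sumset_def)

lemma gen_sumset_Suc_leftI:
  assumes z: "z \<in> gen_sumset j1 j2 A" and a: "a \<in> A"
  shows "z + a \<in> gen_sumset (Suc j1) j2 A"
proof -
  obtain x y where xy: "z = (\<Sum>i<j1. x i) - (\<Sum>i<j2. y i)"
      "\<forall>i<j1. x i \<in> A" "\<forall>i<j2. y i \<in> A"
    using z unfolding gen_sumset_def by blast
  let ?x = "x(j1 := a)"
  have "z + a = (\<Sum>i<Suc j1. ?x i) - (\<Sum>i<j2. y i)"
    using xy(1) by simp
  moreover have "\<forall>i<Suc j1. ?x i \<in> A"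
    using xy(2) a by (simp add: less_Suc_eq)
  ultimately show ?thesis
    using xy(3) unfolding gen_sumset_def by blast
qed

lemma gen_sumset_swap: "gen_sumset j2 j1 A = uminus ` gen_sumset j1 j2 A"
proof -
  have sub: "uminus ` gen_sumset p q A \<subseteq> gen_sumset q p A" for p q
    unfolding gen_sumset_def by fastforce
  have "gen_sumset j2 j1 A = uminus ` uminus ` gen_sumset j2 j1 A"
    by (simp add: image_image)
  also have "\<dots> \<subseteq> uminus ` gen_sumset j1 j2 A"
    using sub by (rule image_mono)
  finally show ?thesis
    using sub by blast
qed

lemma gen_sumset_Suc_rightI:
  assumes "z \<in> gen_sumset j1 j2 A" and "a \<in> A"
  shows "z - a \<in> gen_sumset j1 (Suc j2) A"
proof -
  have "- z \<in> gen_sumset j2 j1 A"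
    using assms(1) by (simp add: gen_sumset_swap[of j2 j1])
  then have "- z + a \<in> gen_sumset (Suc j2) j1 A"
    using assms(2) by (rule gen_sumset_Suc_leftI)
  then have "- (- z + a) \<in> gen_sumset j1 (Suc j2) A"
    unfolding gen_sumset_swap[of j1 "Suc j2"] by (rule imageI)
  then show ?thesis
    by simp
qed

lemma gen_sumset_bounds:
  assumes "A \<subseteq> {1..k}"
  shows "gen_sumset j1 j2 A \<subseteq> {int j1 - k * int j2 .. k * int j1 - int j2}"
proof
  fix z assume "z \<in> gen_sumset j1 j2 A"
  then obtain x y where xy: "z = (\<Sum>i<j1. x i) - (\<Sum>i<j2. y i)"
      "\<forall>i<j1. x i \<in> A" "\<forall>i<j2. y i \<in> A"
    unfolding gen_sumset_def by blast
  have x: "1 \<le> x i \<and> x i \<le> k" if "i < j1" for i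
    using xy(2) that assms by fastforce
  have y: "1 \<le> y i \<and> y i \<le> k" if "i < j2" for i
    using xy(3) that assms by fastforce
  have "int j1 * 1 \<le> sum x {..<j1}" "sum x {..<j1} \<le> int j1 * k"
    using sum_bounded_below[of "{..<j1}" 1 x] sum_bounded_above[of "{..<j1}" x k] x by auto
  moreover have "int j2 * 1 \<le> sum y {..<j2}" "sum y {..<j2} \<le> int j2 * k"
    using sum_bounded_below[of "{..<j2}" 1 y] sum_bounded_above[of "{..<j2}" y k] y by auto
  ultimately show "z \<in> {int j1 - k * int j2 .. k * int j1 - int j2}"
    using xy(1) by (simp add: mult.commute)
qed

section \<open>The fringes\<close>

definition low_fringe :: "int \<Rightarrow> nat \<Rightarrow> nat \<Rightarrow> int \<Rightarrow> int set \<Rightarrow> int set" where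
  "low_fringe n j1 j2 k A = gen_sumset j1 j2 A \<inter> {..<int j1 - k * int j2 + n}"

text \<open>Measured from the least conceivable value \<open>j\<^sub>1 - k j\<^sub>2\<close>, a signed sum is the sum of the
  nonnegative excesses \<open>x - 1\<close> of its pluses and \<open>k - y\<close> of its minuses. If the total is below \<open>n\<close>,
  so is each single excess.\<close>

lemma low_fringe_eq:
  assumes A: "A \<subseteq> {1..k}"
  shows "low_fringe n j1 j2 k A =
    signed_sumset j1 j2 (A \<inter> {..n}) (A \<inter> {k - n<..}) \<inter> {..<int j1 - k * int j2 + n}"
    (is "_ = ?S \<inter> ?I")
proof
  have "?S \<subseteq> gen_sumset j1 j2 A"
    unfolding gen_sumset_eq_signed_sumset by (rule signed_sumset_mono) auto
  then show "?S \<inter> ?I \<subseteq> low_fringe n j1 j2 k A"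
    unfolding low_fringe_def by blast
next
  show "low_fringe n j1 j2 k A \<subseteq> ?S \<inter> ?I"
  proof
    fix z assume z: "z \<in> low_fringe n j1 j2 k A"
    then obtain x y where xy: "z = (\<Sum>i<j1. x i) - (\<Sum>i<j2. y i)"
        "\<forall>i<j1. x i \<in> A" "\<forall>i<j2. y i \<in> A"
      unfolding low_fringe_def gen_sumset_def by blast
    have x: "0 \<le> x i - 1" if "i < j1" for i
      using xy(2) that A by fastforce
    have y: "0 \<le> k - y i" if "i < j2" for i
      using xy(3) that A by fastforce
    have less: "(\<Sum>i<j1. x i - 1) + (\<Sum>i<j2. k - y i) < n"
      using z xy(1) by (simp add: low_fringe_def sum_subtractf algebra_simps)
    have nonneg: "0 \<le> (\<Sum>i<j1. x i - 1)" "0 \<le> (\<Sum>i<j2. k - y i)"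
      using x y by (auto intro!: sum_nonneg)
    have "x i \<in> A \<inter> {..n}" if "i < j1" for i
    proof -
      have "x i - 1 \<le> (\<Sum>i<j1. x i - 1)"
        by (rule member_le_sum) (use that x in auto)
      then show ?thesis
        using less nonneg xy(2) that by simp
    qed
    moreover have "y i \<in> A \<inter> {k - n<..}" if "i < j2" for i
    proof -
      have "k - y i \<le> (\<Sum>i<j2. k - y i)"
        by (rule member_le_sum) (use that y in auto)
      then show ?thesis
        using less nonneg xy(3) that by simp
    qed
    ultimately have "z \<in> ?S"
      using xy(1) unfolding signed_sumset_def by blast
    then show "z \<in> ?S \<inter> ?I"
      using z by (simp add: low_fringe_def)
  qed
qed

lemma signed_sumset_translate_right:
  "signed_sumset j1 j2 X ((+) d ` Y) = (\<lambda>z. z - d * int j2) ` signed_sumset j1 j2 X Y"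
proof
  show "signed_sumset j1 j2 X ((+) d ` Y) \<subseteq> (\<lambda>z. z - d * int j2) ` signed_sumset j1 j2 X Y"
  proof
    fix z assume "z \<in> signed_sumset j1 j2 X ((+) d ` Y)"
    then obtain x y where xy: "z = (\<Sum>i<j1. x i) - (\<Sum>i<j2. y i)"
        "\<forall>i<j1. x i \<in> X" "\<forall>i<j2. y i \<in> (+) d ` Y"
      unfolding signed_sumset_def by blast
    have "\<forall>i<j2. y i - d \<in> Y"
      using xy(3) by auto
    then have "(\<Sum>i<j1. x i) - (\<Sum>i<j2. y i - d) \<in> signed_sumset j1 j2 X Y"
      unfolding signed_sumset_def using xy(2)
      by (intro CollectI exI[of _ x] exI[of _ "\<lambda>i. y i - d"]) simp
    moreover have "z = (\<Sum>i<j1. x i) - (\<Sum>i<j2. y i - d) - d * int j2"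
      using xy(1) by (simp add: sum_subtractf)
    ultimately show "z \<in> (\<lambda>z. z - d * int j2) ` signed_sumset j1 j2 X Y"
      by blast
  qed
next
  show "(\<lambda>z. z - d * int j2) ` signed_sumset j1 j2 X Y \<subseteq> signed_sumset j1 j2 X ((+) d ` Y)"
  proof
    fix z assume "z \<in> (\<lambda>z. z - d * int j2) ` signed_sumset j1 j2 X Y"
    then obtain x y where xy: "z = (\<Sum>i<j1. x i) - (\<Sum>i<j2. y i) - d * int j2"
        "\<forall>i<j1. x i \<in> X" "\<forall>i<j2. y i \<in> Y"
      unfolding signed_sumset_def by blast
    have "z = (\<Sum>i<j1. x i) - (\<Sum>i<j2. d + y i)"
      using xy(1) by (simp add: sum.distrib)
    then show "z \<in> signed_sumset j1 j2 X ((+) d ` Y)"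
      unfolding signed_sumset_def using xy(2,3)
      by (intro CollectI exI[of _ x] exI[of _ "\<lambda>i. d + y i"]) simp
  qed
qed

text \<open>Only the two ends of a set matter for its fringes, and moving one end away from the other
  translates them: replacing \<open>k\<close> by \<open>k'\<close> shifts every minus, and also the threshold, by the same
  amount.\<close>

lemma card_low_fringe_cong:
  assumes "A \<subseteq> {1..k}" "A' \<subseteq> {1..k'}"
    and low: "A' \<inter> {..n} = A \<inter> {..n}"
    and high: "A' \<inter> {k' - n<..} = (+) (k' - k) ` (A \<inter> {k - n<..})"
  shows "card (low_fringe n j1 j2 k' A') = card (low_fringe n j1 j2 k A)"
proof -
  let ?t = "\<lambda>z. z - (k' - k) * int j2"
  have "?t ` {..<int j1 - k * int j2 + n} = {..<int j1 - k' * int j2 + n}"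
  proof
    show "{..<int j1 - k' * int j2 + n} \<subseteq> ?t ` {..<int j1 - k * int j2 + n}"
    proof
      fix z assume "z \<in> {..<int j1 - k' * int j2 + n}"
      then show "z \<in> ?t ` {..<int j1 - k * int j2 + n}"
        by (intro image_eqI[of _ _ "z + (k' - k) * int j2"]) (auto simp: algebra_simps)
    qed
  qed (auto simp: algebra_simps)
  then have "low_fringe n j1 j2 k' A' = ?t ` low_fringe n j1 j2 k A"
    unfolding low_fringe_eq[OF assms(1)] low_fringe_eq[OF assms(2)] low high
      signed_sumset_translate_right
    by (simp add: image_Int inj_on_def)
  then show ?thesis
    by (simp add: card_image inj_on_def)
qed

text \<open>Negation turns the upper fringe for \<open>(j\<^sub>1, j\<^sub>2)\<close> into the lower fringe for
  \<open>(j\<^sub>2, j\<^sub>1)\<close>, so a sumset with full middle is counted by two lower fringes and a term that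
  depends on \<open>j\<^sub>1\<close> and \<open>j\<^sub>2\<close> only through their sum. The last assumption says that the fringes do not overlap.\<close>

lemma card_gen_sumset:
  assumes A: "A \<subseteq> {1..k}"
    and mid: "{int j1 - k * int j2 + n .. k * int j1 - int j2 - n} \<subseteq> gen_sumset j1 j2 A"
    and n: "2 * n \<le> int (j1 + j2) * (k - 1) + 1"
  shows "int (card (gen_sumset j1 j2 A)) =
    int (card (low_fringe n j1 j2 k A)) + int (card (low_fringe n j2 j1 k A))
      + (int (j1 + j2) * (k - 1) + 1 - 2 * n)"
proof -
  let ?S = "gen_sumset j1 j2 A"
  let ?lo = "int j1 - k * int j2" and ?hi = "k * int j1 - int j2"
  let ?M = "{?lo + n .. ?hi - n}" and ?U = "?S \<inter> {?hi - n<..}"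
  let ?L = "low_fringe n j1 j2 k A"
  have fin: "finite ?S"
    by (rule finite_subset[OF gen_sumset_bounds[OF A]]) simp
  have width: "?hi - ?lo = int (j1 + j2) * (k - 1)"
    by (simp add: algebra_simps)
  have ord: "?lo + n \<le> ?hi - n + 1"
    using n width by linarith
  have split: "?S = (?L \<union> ?U) \<union> ?M"
    using mid ord unfolding low_fringe_def by auto
  have "?U = uminus ` low_fringe n j2 j1 k A"
    unfolding low_fringe_def gen_sumset_swap[of j2 j1]
    by (auto intro!: image_eqI[of _ uminus "- _"])
  then have cardU: "card ?U = card (low_fringe n j2 j1 k A)"
    by (simp add: card_image)
  have finL: "finite ?L" and finU: "finite ?U"
    using fin by (simp_all add: low_fringe_def)
  have disj: "?L \<inter> ?U = {}" "(?L \<union> ?U) \<inter> ?M = {}"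
    using ord unfolding low_fringe_def by auto
  have "card ?S = card ?L + card ?U + card ?M"
    using finL finU disj by (subst split) (simp add: card_Un_disjoint)
  moreover have "int (card ?M) = int (j1 + j2) * (k - 1) + 1 - 2 * n"
    using ord width by simp
  ultimately show ?thesis
    using cardU by simp
qed

section \<open>The middle part\<close>

text \<open>Extending an interval by the steps \<open>1\<close>, \<open>k\<close> and those of \<open>[n + 1, k - n]\<close>. Steps \<open>1\<close> and \<open>k\<close>
  reach the two ends of the new range. For a short interval they leave a hole, which the steps
  from \<open>[n + 1, k - n]\<close> close.\<close>

lemma interval_step:
  fixes lo hi k n z :: int
  assumes "3 * n \<le> k" "k - 1 \<le> hi - lo"
    and "lo + 1 + n \<le> z" "z \<le> hi + k - n"
  obtains a where "a \<in> {1, k} \<union> {n + 1..k - n}" "z - a \<in> {lo + n..hi - n}"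
proof -
  consider "z \<le> hi - n + 1" | "lo + n + k \<le> z"
    | "hi - n + 1 < z" "z < lo + n + k" "z \<le> hi + 1"
    | "hi - n + 1 < z" "z < lo + n + k" "hi + 1 < z"
    by linarith
  then show thesis
  proof cases
    case 1
    then show ?thesis using assms by (intro that[of 1]) auto
  next
    case 2
    then show ?thesis using assms by (intro that[of k]) auto
  next
    case 3
    then show ?thesis using assms by (intro that[of "n + 1"]) auto
  next
    case 4
    then show ?thesis using assms by (intro that[of "k - n"]) auto
  qed
qed

lemma middle_subset_gen_sumset:
  assumes A: "{1, k} \<union> {n + 1..k - n} \<subseteq> A"
    and k: "3 * n \<le> k" "1 \<le> k"
    and "1 \<le> j1 + j2"
  shows "{int j1 - k * int j2 + n .. k * int j1 - int j2 - n} \<subseteq> gen_sumset j1 j2 A"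
  using \<open>1 \<le> j1 + j2\<close>
proof (induction "j1 + j2" arbitrary: j1 j2)
  case 0
  then show ?case by simp
next
  case (Suc j)
  show ?case
  proof (cases "j = 0")
    case True
    \<comment> \<open>With one summand the middle part is \<open>[n + 1, k - n]\<close> or its negative.\<close>
    then consider "j1 = 1" "j2 = 0" | "j1 = 0" "j2 = 1"
      using Suc.hyps(2) by linarith
    then show ?thesis
    proof cases
      case 1
      have "z \<in> gen_sumset 1 0 A" if "z \<in> {n + 1..k - n}" for z
        using gen_sumset_Suc_leftI[of 0 0 0 A z] that A by (auto simp: gen_sumset_0_0)
      with 1 show ?thesis by auto
    next
      case 2
      have "z \<in> gen_sumset 0 1 A" if "- z \<in> {n + 1..k - n}" for z
        using gen_sumset_Suc_rightI[of 0 0 0 A "- z"] that A by (auto simp: gen_sumset_0_0)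
      with 2 show ?thesis by auto
    qed
  next
    case False
    \<comment> \<open>The range of possible values is at least as wide as that of a single summand.\<close>
    have width: "k - 1 \<le> (k * int i1 - int i2) - (int i1 - k * int i2)" if "i1 + i2 = j" for i1 i2
    proof -
      have "1 * (k - 1) \<le> int (i1 + i2) * (k - 1)"
        using that False k by (intro mult_right_mono) auto
      then show ?thesis by (simp add: algebra_simps)
    qed
    show ?thesis
    proof (cases j1)
      case (Suc i1)
      then have j: "j = i1 + j2" using Suc.hyps(2) by simp
      show ?thesis
      proof
        fix z assume z: "z \<in> {int j1 - k * int j2 + n .. k * int j1 - int j2 - n}"
        obtain a where a: "a \<in> {1, k} \<union> {n + 1..k - n}"
          "z - a \<in> {int i1 - k * int j2 + n .. k * int i1 - int j2 - n}"
          by (rule interval_step[OF k(1) width[OF j[symmetric]], of z])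
            (use z Suc in \<open>auto simp: algebra_simps\<close>)
        have "z - a \<in> gen_sumset i1 j2 A"
          using Suc.hyps(1)[OF j] a(2) j False by auto
        then have "z - a + a \<in> gen_sumset (Suc i1) j2 A"
          by (rule gen_sumset_Suc_leftI) (use a(1) A in blast)
        then show "z \<in> gen_sumset j1 j2 A"
          using Suc by simp
      qed
    next
      case 0
      then obtain i2 where i2: "j2 = Suc i2" and j: "j = j1 + i2"
        using Suc.hyps(2) by (cases j2) auto
      show ?thesis
      proof
        fix z assume z: "z \<in> {int j1 - k * int j2 + n .. k * int j1 - int j2 - n}"
        \<comment> \<open>The set of steps is invariant under \<open>a \<mapsto> k + 1 - a\<close>, so subtracting \<open>k + 1 - a\<close>
          amounts to adding \<open>a\<close> after a translation by \<open>k + 1\<close>.\<close>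
        obtain a where a: "a \<in> {1, k} \<union> {n + 1..k - n}"
          "z + (k + 1) - a \<in> {int j1 - k * int i2 + n .. k * int j1 - int i2 - n}"
          by (rule interval_step[OF k(1) width[OF j[symmetric]], of "z + (k + 1)"])
            (use z i2 in \<open>auto simp: algebra_simps\<close>)
        have "z + (k + 1) - a \<in> gen_sumset j1 i2 A"
          using Suc.hyps(1)[OF j] a(2) j False by auto
        moreover have "k + 1 - a \<in> A"
          using a(1) by (intro subsetD[OF A]) auto
        ultimately have "z + (k + 1) - a - (k + 1 - a) \<in> gen_sumset j1 (Suc i2) A"
          by (rule gen_sumset_Suc_rightI)
        then show "z \<in> gen_sumset j1 j2 A"
          using i2 by simp
      qed
    qed
  qed
qed

section \<open>Stretching a set\<close>

definition stretch :: "int \<Rightarrow> int \<Rightarrow> int set \<Rightarrow> int set" where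
  "stretch n m A = A \<inter> {..n} \<union> {n + 1..n + m} \<union> (+) m ` (A \<inter> {n<..})"

lemma
  assumes "A \<subseteq> {1..2 * n}" "1 \<in> A" "2 * n \<in> A" "1 \<le> n" "0 \<le> m"
  shows stretch_subset: "stretch n m A \<subseteq> {1..2 * n + m}"
    and one_in_stretch: "1 \<in> stretch n m A"
    and max_in_stretch: "2 * n + m \<in> stretch n m A"
  using assms by (auto simp: stretch_def image_iff)

lemma card_low_fringe_stretch:
  assumes "A \<subseteq> {1..2 * n}" "1 \<in> A" "2 * n \<in> A" "1 \<le> n" "0 \<le> m"
  shows "card (low_fringe n j1 j2 (2 * n + m) (stretch n m A)) = card (low_fringe n j1 j2 (2 * n) A)"
proof (rule card_low_fringe_cong)
  show "stretch n m A \<inter> {..n} = A \<inter> {..n}"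
    using assms by (auto simp: stretch_def)
  show "stretch n m A \<inter> {2 * n + m - n<..} = (+) (2 * n + m - 2 * n) ` (A \<inter> {2 * n - n<..})"
    using assms by (auto simp: stretch_def)
qed (use assms stretch_subset in auto)

lemma middle_subset_gen_sumset_stretch:
  assumes "A \<subseteq> {1..2 * n}" "1 \<in> A" "2 * n \<in> A" "1 \<le> n" "n \<le> m" "1 \<le> j1 + j2"
  shows "{int j1 - (2 * n + m) * int j2 + n .. (2 * n + m) * int j1 - int j2 - n}
    \<subseteq> gen_sumset j1 j2 (stretch n m A)"
proof (rule middle_subset_gen_sumset)
  show "{1, 2 * n + m} \<union> {n + 1..2 * n + m - n} \<subseteq> stretch n m A"
    using one_in_stretch[of A n m] max_in_stretch[of A n m] assms
    by (auto simp: stretch_def)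
qed (use assms in auto)

text \<open>The fringes keep their sizes, and the middle part grows by \<open>j m\<close> elements.\<close>

lemma card_gen_sumset_stretch:
  assumes A: "A \<subseteq> {1..2 * n}" "1 \<in> A" "2 * n \<in> A" and n: "1 \<le> n" "n \<le> m"
    and j: "1 \<le> j1 + j2"
    and mid: "{int j1 - 2 * n * int j2 + n .. 2 * n * int j1 - int j2 - n} \<subseteq> gen_sumset j1 j2 A"
  shows "int (card (gen_sumset j1 j2 (stretch n m A))) =
    int (card (gen_sumset j1 j2 A)) + int (j1 + j2) * m"
proof -
  have m: "0 \<le> m" using n by linarith
  have fringes_apart: "2 * n \<le> int (j1 + j2) * (k - 1) + 1" if "2 * n \<le> k" for k
  proof -
    have "1 * (k - 1) \<le> int (j1 + j2) * (k - 1)"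
      using j n that by (intro mult_right_mono) auto
    then show ?thesis using that by simp
  qed
  show ?thesis
    using card_gen_sumset[OF A(1) mid fringes_apart]
      card_gen_sumset[OF stretch_subset[OF A n(1) m]
        middle_subset_gen_sumset_stretch[OF A n j] fringes_apart]
      card_low_fringe_stretch[OF A n(1) m] m
    by (simp add: algebra_simps)
qed

text \<open>A larger \<open>n\<close> asks for less.\<close>

lemma P_set_stretch:
  assumes A: "A \<subseteq> {1..2 * n}" "1 \<in> A" "2 * n \<in> A" and n: "1 \<le> n" "n \<le> m"
    and "1 \<le> j" "n \<le> n'"
  shows "P_set n' j (stretch n m A)"
  unfolding P_set_def
proof (intro exI conjI allI impI)
  fix j1 j2 :: nat assume "j1 + j2 = j"
  then have "{int j1 - (2 * n + m) * int j2 + n .. (2 * n + m) * int j1 - int j2 - n}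
      \<subseteq> gen_sumset j1 j2 (stretch n m A)"
    using assms by (intro middle_subset_gen_sumset_stretch) auto
  then show "{int j1 - (2 * n + m) * int j2 + n' .. (2 * n + m) * int j1 - int j2 - n'}
      \<subseteq> gen_sumset j1 j2 (stretch n m A)"
    using \<open>n \<le> n'\<close> by (auto elim!: subset_trans[rotated])
qed (use assms stretch_subset one_in_stretch max_in_stretch in auto)

lemma P_setD:
  assumes "P_set n j A" "A \<subseteq> {1..k}" "k \<in> A" "j1 + j2 = j"
  shows "{int j1 - k * int j2 + n .. k * int j1 - int j2 - n} \<subseteq> gen_sumset j1 j2 A"
proof -
  obtain l where l: "A \<subseteq> {1..l}" "l \<in> A"
      "{int j1 - l * int j2 + n .. l * int j1 - int j2 - n} \<subseteq> gen_sumset j1 j2 A"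
    using assms(1,4) unfolding P_set_def by blast
  moreover have "l = k"
    using l(1,2) assms(2,3) by fastforce
  ultimately show ?thesis by simp
qed

section \<open>The infinite family\<close>


theorem theorem4p4:
  fixes j j1 j2 j1' j2' :: nat
  assumes "j \<in> {2, 3}"
    and "j1 + j2 = j"
    and "j1' + j2' = j"
    and "\<exists>(n::int) A. n \<ge> 1 \<and> finite A \<and> P_set n j A
           \<and> A \<subseteq> {1..2 * n} \<and> 1 \<in> A \<and> 2 * n \<in> A
           \<and> card (gen_sumset j1 j2 A) > card (gen_sumset j1' j2' A)"
  shows "infinite {A. finite A \<and> (\<exists>n::int. n \<ge> 1 \<and> P_set n j A
           \<and> A \<subseteq> {1..2 * n} \<and> 1 \<in> A \<and> 2 * n \<in> A
           \<and> card (gen_sumset j1 j2 A) > card (gen_sumset j1' j2' A))}"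
proof -
  have j: "1 \<le> j1 + j2" "1 \<le> j1' + j2'" "1 \<le> j"
    using assms(1-3) by auto
  obtain n :: int and A where n: "1 \<le> n" and P: "P_set n j A"
    and A: "A \<subseteq> {1..2 * n}" "1 \<in> A" "2 * n \<in> A"
    and less: "card (gen_sumset j1' j2' A) < card (gen_sumset j1 j2 A)"
    using assms(4) by blast
  \<comment> \<open>The shifts are even, so that the new maximum is again even, and at least \<open>n\<close>.\<close>
  define m where "m t = 2 * (n + int t)" for t :: nat
  define B where "B t = stretch n (m t) A" for t
  have m: "n \<le> m t" "0 \<le> m t" for t
    using n by (simp_all add: m_def)
  have B: "B t \<subseteq> {1..2 * n + m t}" "1 \<in> B t" "2 * n + m t \<in> B t" for t
    unfolding B_def
    using stretch_subset[OF A n m(2)] one_in_stretch[OF A n m(2)] max_in_stretch[OF A n m(2)]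
    by auto
  have max_B: "Max (B t) = 2 * n + m t" for t
    using B[of t] by (intro Max_eqI) (auto intro: finite_subset)
  have "inj B"
  proof (rule injI)
    fix s t assume "B s = B t"
    then have "2 * n + m s = 2 * n + m t"
      using max_B by metis
    then show "s = t"
      by (simp add: m_def)
  qed
  have card: "int (card (gen_sumset p q (B t))) = int (card (gen_sumset p q A)) + int j * m t"
    if "p + q = j" for p q t
    using card_gen_sumset_stretch[OF A n m(1) _ P_setD[OF P A(1,3) that]] that j(3)
    by (simp add: B_def)
  let ?F = "{A. finite A \<and> (\<exists>n::int. n \<ge> 1 \<and> P_set n j A
           \<and> A \<subseteq> {1..2 * n} \<and> 1 \<in> A \<and> 2 * n \<in> A
           \<and> card (gen_sumset j1 j2 A) > card (gen_sumset j1' j2' A))}"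
  have "B t \<in> ?F" for t
  proof (intro CollectI conjI exI)
    let ?n = "2 * n + int t"
    have n': "2 * ?n = 2 * n + m t" by (simp add: m_def)
    show "finite (B t)"
      using B(1) by (rule finite_subset) simp
    show "1 \<le> ?n"
      using n by simp
    show "P_set ?n j (B t)"
      unfolding B_def using n j(3) by (intro P_set_stretch A m) auto
    show "B t \<subseteq> {1..2 * ?n}" "1 \<in> B t" "2 * ?n \<in> B t"
      unfolding n' by (fact B)+
    show "card (gen_sumset j1' j2' (B t)) < card (gen_sumset j1 j2 (B t))"
      using less card[OF assms(2), of t] card[OF assms(3), of t] by linarith
  qed
  then have "range B \<subseteq> ?F"
    by blast
  moreover have "infinite (range B)"
    using \<open>inj B\<close> by (simp add: finite_image_iff)
  ultimately show ?thesis
    by (rule infinite_super)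
qed

end
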